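(* Let $P(z)=\sum_{k}p_kz^k$ be a polynomial all of whose roots are negative real numbers, let $\psi$ be a function from the Stieltjes class $\mathbf{S}$, and let $P_{\psi}$ be the polynomial $$P_{\psi}(z)=\sum_{k}p_k\,\psi(k+1)z^k.$$ Then the polynomial $P_{\psi}$ is stable.
   Context: A polynomial (with complex coefficients) is called stable if all its roots lie in the open left half-plane $\{z:\operatorname{Re}z<0\}$. Stieltjes class $\mathbf{S}$: a function $\psi$ holomorphic in $\mathbb{C}\setminus(-\infty,0]$ belongs to $\mathbf{S}$ if $\psi(x)>0$ for $0<x<\infty$ and $\operatorname{Im}\psi(z)\le0$ whenever $\operatorname{Im}z\ge0$ (with $z$ in the domain of $\psi$). *)

theory Defs
  imports "HOL-Complex_Analysis.Complex_Analysis" "HOL-Computational_Algebra.Polynomial"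
begin

text \<open>The zero polynomial vanishes everywhere, so it is not stable.\<close>

definition stable_poly :: "complex poly \<Rightarrow> bool" where
  "stable_poly P \<longleftrightarrow> (\<forall>z. poly P z = 0 \<longrightarrow> Re z < 0)"

text \<open>Values of \<open>\<psi>\<close> on the cut \<open>(-\<infinity>, 0]\<close> are irrelevant.\<close>

definition stieltjes_class :: "(complex \<Rightarrow> complex) set" where
  "stieltjes_class = {\<psi>.
     \<psi> holomorphic_on (- \<real>\<^sub>\<le>\<^sub>0) \<and>
     (\<forall>x::real. x > 0 \<longrightarrow> \<psi> (of_real x) \<in> \<real> \<and> Re (\<psi> (of_real x)) > 0) \<and>
     (\<forall>z. z \<notin> \<real>\<^sub>\<le>\<^sub>0 \<longrightarrow> Im z \<ge> 0 \<longrightarrow> Im (\<psi> z) \<le> 0)}"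

definition multiplier_poly :: "(complex \<Rightarrow> complex) \<Rightarrow> complex poly \<Rightarrow> complex poly" where
  "multiplier_poly \<psi> P = (\<Sum>k\<le>degree P. monom (coeff P k * \<psi> (of_nat (k + 1))) k)"

end

theory Submission
  imports Defs "HOL-Real_Asymp.Real_Asymp" "HOL-Computational_Algebra.Fundamental_Theorem_Algebra"
begin

text \<open>
  Fix \<open>z\<close> with \<open>Re z \<ge> 0\<close> and \<open>Im z > 0\<close>. The functional
  \<open>\<psi> \<mapsto> Im (P z * cnj (P\<^sub>\<psi> z)) = (\<Sum>k. L k * \<psi> (k + 1))\<close> vanishes on constants and is positive
  on every resolvent \<open>\<psi> x = 1 / (x + t)\<close> with \<open>t \<ge> 0\<close>: there \<open>P\<^sub>\<psi> z\<close> is the integral of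
  \<open>s powr t * P (s * z)\<close> over \<open>0 < s < 1\<close>, and along this ray the argument of \<open>P\<close> increases
  at a decreasing rate while its modulus increases, so the integral stays inside a disc tangent to the
  direction of \<open>P z\<close>. A Stieltjes function pulled back to the unit disc is
  typically real, and Cauchy's formula on circles of radius tending to \<open>1\<close> writes it as a limit of
  combinations of constants and resolvents in which the resolvents have positive weights, so positivity passes to
  \<open>\<psi>\<close>, strictly unless \<open>\<psi>\<close> is constant on the points \<open>1, \<dots>, deg P + 1\<close>.
\<close>

section \<open>A planar differential inequality\<close>

text \<open>In the application \<open>p + \<i> q\<close> is the quotient \<open>u\<close> of the
  resolvent multiplier polynomial by \<open>P\<close> at \<open>s * z\<close>, and
  \<open>A + \<i> B\<close> is the logarithmic derivative \<open>l\<close> of \<open>P\<close> along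
  this ray. The two equations are the real and imaginary parts of
  \<open>s * u' = 1 - (1 + t) * u - s * l * u\<close>. A maximum argument traps the curve in a
  moving disc; excluding a boundary point at \<open>s = 1\<close> gives strictness.\<close>

lemma planar_comparison:
  fixes p q A B p' q' B' :: "real \<Rightarrow> real" and t :: real
  assumes t: "0 \<le> t"
    and dp: "\<And>s. 0 \<le> s \<Longrightarrow> s \<le> 1 \<Longrightarrow> (p has_real_derivative p' s) (at s)"
    and dq: "\<And>s. 0 \<le> s \<Longrightarrow> s \<le> 1 \<Longrightarrow> (q has_real_derivative q' s) (at s)"
    and dB: "\<And>s. 0 \<le> s \<Longrightarrow> s \<le> 1 \<Longrightarrow> (B has_real_derivative B' s) (at s)"
    and ode_p: "\<And>s. 0 \<le> s \<Longrightarrow> s \<le> 1 \<Longrightarrow> s * p' s = 1 - (1 + t) * p s - s * (A s * p s - B s * q s)"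
    and ode_q: "\<And>s. 0 \<le> s \<Longrightarrow> s \<le> 1 \<Longrightarrow> s * q' s = - ((1 + t) * q s) - s * (A s * q s + B s * p s)"
    and A: "\<And>s. 0 < s \<Longrightarrow> s \<le> 1 \<Longrightarrow> 0 < A s"
    and A_cont: "continuous_on {0..1} A"
    and B: "\<And>s. 0 \<le> s \<Longrightarrow> s \<le> 1 \<Longrightarrow> 0 < B s"
    and B': "\<And>s. 0 \<le> s \<Longrightarrow> s \<le> 1 \<Longrightarrow> B' s \<le> 0"
  shows "q 1 < 0"
proof -
  define m where "m s = (p s)\<^sup>2 + (q s)\<^sup>2" for s
  \<comment> \<open>\<open>\<phi> s \<le> 0\<close> says that \<open>(p s, q s)\<close> lies in the disc of radius \<open>1 / (s * B s)\<close> touching the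
    line \<open>q = 0\<close> from below at the origin. \<open>B' \<le> 0\<close>, \<open>A > 0\<close> and \<open>t \<ge> 0\<close> make the disc invariant.\<close>
  define \<phi> where "\<phi> s = s * B s * m s + 2 * q s" for s
  define \<phi>' where "\<phi>' s = (B s + s * B' s) * m s + s * B s * (2 * p s * p' s + 2 * q s * q' s) + 2 * q' s" for s
  have d\<phi>: "(\<phi> has_real_derivative \<phi>' s) (at s)" if "0 \<le> s" "s \<le> 1" for s
    unfolding \<phi>_def \<phi>'_def m_def using that
    by (auto intro!: derivative_eq_intros dp dq dB simp: algebra_simps power2_eq_square)
  \<comment> \<open>The equations combine into a damping term in \<open>\<phi>\<close> and a term of
    fixed sign, so \<open>\<phi>\<close> strictly decreases at every \<open>s > 0\<close> where it
    is positive.\<close>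
  have eq: "s * \<phi>' s = - ((1 + t + s * A s) * \<phi> s) - m s * (- (s\<^sup>2 * B' s) + t * s * B s + s\<^sup>2 * A s * B s)"
    if "0 \<le> s" "s \<le> 1" for s
  proof -
    have "s * \<phi>' s = s * B s * m s + s\<^sup>2 * B' s * m s
        + s * B s * (2 * p s * (s * p' s) + 2 * q s * (s * q' s)) + 2 * (s * q' s)"
      by (simp add: \<phi>'_def algebra_simps power2_eq_square)
    also have "\<dots> = - ((1 + t + s * A s) * \<phi> s) - m s * (- (s\<^sup>2 * B' s) + t * s * B s + s\<^sup>2 * A s * B s)"
      unfolding ode_p[OF that] ode_q[OF that] \<phi>_def m_def by algebra
    finally show ?thesis .
  qed
  have c\<phi>: "continuous_on {0..1} \<phi>"
    by (intro DERIV_atLeastAtMost_imp_continuous_on) (use d\<phi> in auto)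
  have bracket: "0 < - (s\<^sup>2 * B' s) + t * s * B s + s\<^sup>2 * A s * B s" if "0 < s" "s \<le> 1" for s
  proof -
    have "0 \<le> - (s\<^sup>2 * B' s)" using B'[of s] that by (simp add: mult_nonneg_nonpos)
    moreover have "0 \<le> t * s * B s" using B[of s] that t by simp
    moreover have "0 < s\<^sup>2 * A s * B s" using B[of s] A[of s] that by simp
    ultimately show ?thesis by linarith
  qed
  have m0: "0 \<le> m s" for s by (simp add: m_def)
  \<comment> \<open>The equation degenerates at \<open>s = 0\<close> to
    \<open>(1 + t) * q 0 = 0\<close>. Hence \<open>\<phi> 0 = 0\<close>, and a positive maximum can
    only lie at some \<open>x > 0\<close>.\<close>
  have q0: "q 0 = 0" using ode_q[of 0] t by auto
  have le: "\<phi> s \<le> 0" if s: "0 \<le> s" "s \<le> 1" for s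
  proof -
    obtain x where x: "x \<in> {0..1}" and max: "\<And>y. y \<in> {0..1} \<Longrightarrow> \<phi> y \<le> \<phi> x"
      using continuous_attains_sup[OF compact_Icc _ c\<phi>] by auto
    have "\<phi> x \<le> 0"
    proof (rule ccontr)
      assume pos: "\<not> \<phi> x \<le> 0"
      then have "x \<noteq> 0" by (auto simp: \<phi>_def q0 intro: ccontr)
      with x have x': "0 < x" "x \<le> 1" by auto
      have "0 < (1 + t + x * A x) * \<phi> x"
        using pos A[OF x'] x' t by (intro mult_pos_pos add_pos_pos add_pos_nonneg) auto
      moreover have "0 \<le> m x * (- (x\<^sup>2 * B' x) + t * x * B x + x\<^sup>2 * A x * B x)"
        using bracket[OF x'] m0[of x] by simp
      ultimately have "x * \<phi>' x < 0" using eq[of x] x' by linarith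
      then have "\<phi>' x < 0" using x' by (simp add: mult_less_0_iff)
      \<comment> \<open>Only points to the left of \<open>x\<close> are compared, so the maximum may
        sit at the endpoint \<open>1\<close>.\<close>
      from DERIV_neg_dec_left[OF d\<phi> this] x'
      obtain d where d: "d > 0" "\<And>h. 0 < h \<Longrightarrow> h < d \<Longrightarrow> \<phi> x < \<phi> (x - h)" by auto
      define h where "h = min (d/2) x"
      have "\<phi> x < \<phi> (x - h)" using d x' by (intro d(2)) (auto simp: h_def)
      moreover have "\<phi> (x - h) \<le> \<phi> x" using x' d by (intro max) (auto simp: h_def)
      ultimately show False by simp
    qed
    with max[of s] s show ?thesis by auto
  qed
  show ?thesis
  proof (rule ccontr)
    assume "\<not> q 1 < 0"
    moreover have "0 \<le> B 1 * m 1" using B[of 1] m0[of 1] by simp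
    ultimately have \<phi>1: "\<phi> 1 = 0" using le[of 1] by (simp add: \<phi>_def)
    obtain K where K: "\<And>s. s \<in> {0..1} \<Longrightarrow> \<bar>A s\<bar> \<le> K"
      using compact_imp_bounded[OF compact_continuous_image[OF A_cont compact_Icc]]
      unfolding bounded_iff by (metis imageI real_norm_def)
    \<comment> \<open>Integrating factor: away from the singular point \<open>0\<close>,
      \<open>M\<close> is large enough for \<open>x * M\<close> to dominate the damping coefficient.
      As \<open>\<phi> \<le> 0\<close>, \<open>W\<close> is nonincreasing, and
      \<open>W 1 = 0\<close> yields the reverse inequality.\<close>
    have zero: "\<phi> s = 0" if s: "1/2 \<le> s" "s \<le> 1" for s
    proof -
      define M where "M = 2 * (1 + t) + K"
      define W where "W x = exp (M * x) * \<phi> x" for x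
      have "W 1 \<le> W s"
      proof (rule DERIV_nonpos_imp_nonincreasing[OF \<open>s \<le> 1\<close>])
        fix x assume x: "s \<le> x" "x \<le> 1"
        then have x': "0 < x" "1/2 \<le> x" using s by auto
        have "(W has_real_derivative exp (M * x) * (M * \<phi> x + \<phi>' x)) (at x)"
          unfolding W_def using x x'
          by (auto intro!: derivative_eq_intros d\<phi> simp: algebra_simps)
        moreover have "M * \<phi> x + \<phi>' x \<le> 0"
        proof -
          have "x * (M * \<phi> x + \<phi>' x) = (x * M - (1 + t + x * A x)) * \<phi> x
              - m x * (- (x\<^sup>2 * B' x) + t * x * B x + x\<^sup>2 * A x * B x)"
            using eq[of x] x x' by (simp add: algebra_simps)
          moreover have "0 \<le> m x * (- (x\<^sup>2 * B' x) + t * x * B x + x\<^sup>2 * A x * B x)"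
            using bracket[of x] x x' m0[of x] by simp
          moreover have "(x * M - (1 + t + x * A x)) * \<phi> x \<le> 0"
          proof (rule mult_nonneg_nonpos)
            have "x * A x \<le> x * K" using K[of x] x x' by (intro mult_left_mono) auto
            moreover have "1/2 * (1 + t) \<le> x * (1 + t)" using x' t by (intro mult_right_mono) auto
            ultimately show "0 \<le> x * M - (1 + t + x * A x)"
              by (simp add: M_def algebra_simps)
          qed (use le x x' in auto)
          ultimately have "x * (M * \<phi> x + \<phi>' x) \<le> 0" by linarith
          then show ?thesis using x' by (simp add: mult_le_0_iff)
        qed
        ultimately show "\<exists>y. (W has_real_derivative y) (at x) \<and> y \<le> 0"
          by (auto simp: mult_le_0_iff)
      qed
      then have "0 \<le> \<phi> s" by (simp add: W_def \<phi>1 zero_le_mult_iff)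
      with le[of s] s show ?thesis by auto
    qed
    \<comment> \<open>Where \<open>\<phi>\<close> vanishes on an interval its derivative vanishes
      too, and \<open>eq\<close> leaves \<open>m s\<close> times a positive bracket equal to
      \<open>0\<close>.\<close>
    have m_zero: "m s = 0" if s: "1/2 < s" "s < 1" for s
    proof -
      have "\<phi>' s = 0"
      proof (rule DERIV_local_const[OF d\<phi>])
        show "0 < min (s - 1/2) (1 - s)" using s by simp
        show "\<forall>y. \<bar>s - y\<bar> < min (s - 1/2) (1 - s) \<longrightarrow> \<phi> s = \<phi> y"
          using s zero by (auto simp: abs_less_iff)
      qed (use s in auto)
      then show ?thesis using eq[of s] zero[of s] bracket[of s] s by simp
    qed
    then have p_zero: "p s = 0" if "1/2 < s" "s < 1" for s
      using m_zero[OF that] by (simp add: m_def add_nonneg_eq_0_iff)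
    \<comment> \<open>The curve would rest at the origin, where \<open>ode_p\<close> reads
      \<open>0 = 1\<close>; \<open>3/4\<close> is just an interior point of the interval.\<close>
    have "p' (3/4) = 0"
    proof (rule DERIV_local_const[OF dp])
      show "\<forall>y. \<bar>3/4 - y\<bar> < 1/4 \<longrightarrow> p (3/4) = p y"
      proof (intro allI impI)
        fix y :: real assume "\<bar>3/4 - y\<bar> < 1/4"
        then have "1/2 < y" "y < 1" by linarith+
        then show "p (3/4) = p y" by (simp add: p_zero)
      qed
    qed auto
    moreover have "p (3/4) = 0" "q (3/4) = 0"
      using m_zero[of "3/4"] by (simp_all add: m_def add_nonneg_eq_0_iff)
    ultimately show False using ode_p[of "3/4"] by simp
  qed
qed

section \<open>Typically real functions and the Stieltjes class\<close>

text \<open>Reflection principle: \<open>cnj (f (cnj w))\<close> is holomorphic too and agrees with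
  \<open>f\<close> on the real points of the disc, which accumulate at \<open>0\<close>.\<close>

lemma cnj_symmetric_of_real_on_Reals:
  fixes f :: "complex \<Rightarrow> complex"
  assumes holo: "f holomorphic_on ball 0 1"
    and real: "\<And>x. x \<in> \<real> \<Longrightarrow> norm x < 1 \<Longrightarrow> f x \<in> \<real>"
    and w: "norm w < 1"
  shows "f (cnj w) = cnj (f w)"
proof -
  have [simp]: "cnj ` ball 0 1 = ball 0 1"
    by (auto simp: image_iff intro!: bexI[of _ "cnj _"])
  have "cnj \<circ> f \<circ> cnj holomorphic_on ball 0 1"
    by (rule holomorphic_on_compose_cnj_cnj) (use holo in auto)
  then have "(\<lambda>w. (cnj \<circ> f \<circ> cnj) w - f w) holomorphic_on ball 0 1"
    by (intro holomorphic_intros holo)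
  moreover have "0 islimpt (\<real> \<inter> ball 0 1 :: complex set)"
  proof -
    have "\<exists>x\<in>\<real> \<inter> ball 0 1. x \<noteq> 0 \<and> dist x (0::complex) < e" if "0 < e" for e
      by (rule bexI[of _ "of_real (min e 1 / 2)"]) (use that in auto)
    then show ?thesis unfolding islimpt_approachable by blast
  qed
  moreover have "(cnj \<circ> f \<circ> cnj) x - f x = 0" if "x \<in> \<real> \<inter> ball 0 1" for x
    using real[of x] that by (auto simp: Reals_cnj_iff)
  ultimately have "(cnj \<circ> f \<circ> cnj) w - f w = 0"
    using analytic_continuation[of "\<lambda>w. (cnj \<circ> f \<circ> cnj) w - f w" "ball 0 1" "\<real> \<inter> ball 0 1" 0 w]
      w by auto
  then show ?thesis by (metis comp_apply complex_cnj_cnj eq_iff_diff_eq_0)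
qed

text \<open>On the unit circle \<open>\<zeta> - w = \<zeta> * (1 - w * cnj \<zeta>)\<close>, so
  after multiplication by \<open>\<zeta>\<close> the two kernels are conjugate and their difference
  is imaginary. The real denominator is the squared modulus of
  \<open>1 - w * \<zeta>\<close>.\<close>

lemma circle_kernel_eq:
  fixes w c s :: real
  assumes w: "\<bar>w\<bar> < 1" and cs: "c\<^sup>2 + s\<^sup>2 = 1"
  defines "\<zeta> \<equiv> Complex c s"
  shows "(1 / (1 - of_real w * \<zeta>) / \<zeta> - 1 / (\<zeta> - of_real w)) * \<zeta>
    = \<i> * of_real (2 * s * (w / (1 - 2 * w * c + w\<^sup>2)))"
proof -
  have norm: "norm \<zeta> = 1" using cs by (simp add: \<zeta>_def cmod_def)
  have \<zeta>: "\<zeta> * cnj \<zeta> = 1" "\<zeta> \<noteq> 0"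
    using cs norm by (auto simp: \<zeta>_def complex_mult_cnj simp flip: of_real_power of_real_add)
  have nz: "1 - of_real w * \<zeta> \<noteq> 0" "1 - of_real w * cnj \<zeta> \<noteq> 0"
    using w norm by (metis complex_mod_cnj eq_iff_diff_eq_0 less_irrefl mult.right_neutral norm_mult norm_of_real norm_one)+
  have arith: "(1 / d / x - 1 / (x * e)) * x = 1 / d - 1 / e"
    if "x \<noteq> 0" "d \<noteq> 0" "e \<noteq> 0" for x d e :: complex
    using that by (simp add: field_simps)
  have "\<zeta> - of_real w = \<zeta> * (1 - of_real w * cnj \<zeta>)"
    using \<zeta> by (simp add: right_diff_distrib mult.left_commute)
  then have "(1 / (1 - of_real w * \<zeta>) / \<zeta> - 1 / (\<zeta> - of_real w)) * \<zeta>
      = 1 / (1 - of_real w * \<zeta>) - 1 / (1 - of_real w * cnj \<zeta>)"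
    using arith[OF \<zeta>(2) nz] by simp
  also have "\<dots> = of_real w * (\<zeta> - cnj \<zeta>) / ((1 - of_real w * \<zeta>) * (1 - of_real w * cnj \<zeta>))"
    using nz by (simp add: field_simps)
  also have "(1 - of_real w * \<zeta>) * (1 - of_real w * cnj \<zeta>) = of_real (1 - 2 * w * c + w\<^sup>2)"
  proof -
    have "(1 - of_real w * \<zeta>) * (1 - of_real w * cnj \<zeta>)
        = 1 - of_real w * (\<zeta> + cnj \<zeta>) + (of_real w)\<^sup>2 * (\<zeta> * cnj \<zeta>)"
      by (simp add: algebra_simps power2_eq_square)
    also have "\<zeta> + cnj \<zeta> = of_real (2 * c)" by (simp add: \<zeta>_def complex_add_cnj)
    finally show ?thesis using \<zeta> by simp
  qed
  also have "\<zeta> - cnj \<zeta> = \<i> * of_real (2 * s)" by (simp add: \<zeta>_def complex_diff_cnj)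
  finally show ?thesis by simp
qed

text \<open>Cauchy's formula turns the combination into the mean over the circle of
  \<open>-2 * E c * (s * Im (G \<zeta>))\<close> with \<open>\<zeta> = c + \<i> s\<close>. Here
  \<open>ker\<close> gives \<open>E c \<ge> 0\<close>, and the sign and symmetry of \<open>G\<close>
  give \<open>s * Im (G \<zeta>) \<le> 0\<close>.\<close>

lemma typically_real_combination_cball:
  fixes G :: "complex \<Rightarrow> complex" and w lam :: "'a \<Rightarrow> real"
  assumes holo: "G holomorphic_on cball 0 1"
    and sym: "\<And>\<zeta>. norm \<zeta> = 1 \<Longrightarrow> G (cnj \<zeta>) = cnj (G \<zeta>)"
    and Im: "\<And>\<zeta>. norm \<zeta> = 1 \<Longrightarrow> 0 \<le> Im \<zeta> \<Longrightarrow> Im (G \<zeta>) \<le> 0"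
    and K: "finite K" and w: "\<And>k. k \<in> K \<Longrightarrow> \<bar>w k\<bar> < 1"
    and ker: "\<And>c. \<bar>c\<bar> \<le> 1 \<Longrightarrow> 0 \<le> (\<Sum>k\<in>K. lam k * (w k / (1 - 2 * w k * c + (w k)\<^sup>2)))"
  shows "0 \<le> (\<Sum>k\<in>K. lam k * Re (G 0 - G (of_real (w k))))"
proof -
  define S where "S = (\<Sum>k\<in>K. of_real (lam k) * (G 0 - G (of_real (w k))))"
  \<comment> \<open>On the circle \<open>1 / \<zeta>\<close> is \<open>cnj \<zeta>\<close>, so that \<open>\<zeta> * \<kappa> k \<zeta>\<close> is purely imaginary there and only
    the imaginary part of \<open>G\<close> contributes to the real part of the integral.\<close>
  define \<kappa> where "\<kappa> k \<zeta> = 1 / (1 - of_real (w k) * \<zeta>) / \<zeta> - 1 / (\<zeta> - of_real (w k))" for k and \<zeta> :: complex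
  define E where "E c = (\<Sum>k\<in>K. lam k * (w k / (1 - 2 * w k * c + (w k)\<^sup>2)))" for c
  have single: "((\<lambda>\<zeta>. G \<zeta> * \<kappa> k \<zeta>) has_contour_integral
      2 * of_real pi * \<i> * (G 0 - G (of_real (w k)))) (circlepath 0 1)" if k: "k \<in> K" for k
  proof -
    have nz: "1 - of_real (w k) * \<zeta> \<noteq> 0" if "\<zeta> \<in> cball 0 1" for \<zeta> :: complex
    proof
      assume "1 - of_real (w k) * \<zeta> = 0"
      then have "1 = \<bar>w k\<bar> * norm \<zeta>"
        by (metis eq_iff_diff_eq_0 norm_mult norm_of_real norm_one)
      also have "\<dots> \<le> \<bar>w k\<bar> * 1" using that by (intro mult_left_mono) auto
      finally show False using w[OF k] by simp
    qed
    \<comment> \<open>The extra factor is holomorphic on the closed disc and equals \<open>1\<close>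
      at the centre, so it keeps the value \<open>G 0\<close> while supplying the conjugate
      kernel.\<close>
    have "((\<lambda>\<zeta>. G \<zeta> / (1 - of_real (w k) * \<zeta>) / (\<zeta> - 0)) has_contour_integral
        2 * of_real pi * \<i> * (G 0 / (1 - of_real (w k) * 0))) (circlepath 0 1)"
      using nz by (intro Cauchy_integral_circlepath_simple holomorphic_intros holo) auto
    moreover have "((\<lambda>\<zeta>. G \<zeta> / (\<zeta> - of_real (w k))) has_contour_integral
        2 * of_real pi * \<i> * G (of_real (w k))) (circlepath 0 1)"
      using w[OF k] by (intro Cauchy_integral_circlepath_simple holo) auto
    ultimately have "((\<lambda>\<zeta>. G \<zeta> / (1 - of_real (w k) * \<zeta>) / (\<zeta> - 0) - G \<zeta> / (\<zeta> - of_real (w k)))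
        has_contour_integral 2 * of_real pi * \<i> * (G 0 / (1 - of_real (w k) * 0))
          - 2 * of_real pi * \<i> * G (of_real (w k))) (circlepath 0 1)"
      by (rule has_contour_integral_diff)
    then show ?thesis by (simp add: \<kappa>_def algebra_simps)
  qed
  have "((\<lambda>\<zeta>. \<Sum>k\<in>K. of_real (lam k) * (G \<zeta> * \<kappa> k \<zeta>)) has_contour_integral
      (\<Sum>k\<in>K. of_real (lam k) * (2 * of_real pi * \<i> * (G 0 - G (of_real (w k)))))) (circlepath 0 1)"
    by (intro has_contour_integral_sum has_contour_integral_lmul single K)
  also have "(\<Sum>k\<in>K. of_real (lam k) * (2 * of_real pi * \<i> * (G 0 - G (of_real (w k)))))
      = 2 * of_real pi * \<i> * S"
    by (simp add: S_def sum_distrib_left algebra_simps)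
  finally have int: "((\<lambda>x. (\<Sum>k\<in>K. of_real (lam k) * (G (circlepath 0 1 x) * \<kappa> k (circlepath 0 1 x)))
      * vector_derivative (circlepath 0 1) (at x within {0..1})) has_integral 2 * of_real pi * \<i> * S) {0..1}"
    by (simp add: has_contour_integral_def)
  define f where "f x = G (Complex (cos (2 * pi * x)) (sin (2 * pi * x)))
      * (\<i> * of_real (2 * sin (2 * pi * x) * E (cos (2 * pi * x))))" for x
  have "((\<lambda>x. 2 * of_real pi * \<i> * f x) has_integral 2 * of_real pi * \<i> * S) {0..1}"
  proof (rule has_integral_eq[OF _ int])
    fix x :: real assume x: "x \<in> {0..1}"
    define c s where "c = cos (2 * pi * x)" and "s = sin (2 * pi * x)"
    define \<zeta> where "\<zeta> = Complex c s"
    have cs: "c\<^sup>2 + s\<^sup>2 = 1" by (simp add: c_def s_def)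
    have exp: "exp (2 * of_real pi * \<i> * of_real x) = \<zeta>"
      unfolding \<zeta>_def c_def s_def
      by (simp add: complex_eq_iff Re_exp Im_exp)
    have circ: "circlepath 0 1 x = \<zeta>" by (simp add: circlepath exp)
    have vd: "vector_derivative (circlepath 0 1) (at x within {0..1}) = 2 * of_real pi * \<i> * \<zeta>"
      using x exp by (simp add: vector_derivative_circlepath01)
    have "(\<Sum>k\<in>K. of_real (lam k) * (G \<zeta> * \<kappa> k \<zeta>)) * (2 * of_real pi * \<i> * \<zeta>)
        = 2 * of_real pi * \<i> * (G \<zeta> * (\<Sum>k\<in>K. of_real (lam k) * (\<kappa> k \<zeta> * \<zeta>)))"
      by (simp add: sum_distrib_left sum_distrib_right algebra_simps)
    also have "(\<Sum>k\<in>K. of_real (lam k) * (\<kappa> k \<zeta> * \<zeta>))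
        = (\<Sum>k\<in>K. of_real (lam k) * (\<i> * of_real (2 * s * (w k / (1 - 2 * w k * c + (w k)\<^sup>2)))))"
      unfolding \<kappa>_def \<zeta>_def using circle_kernel_eq[OF w cs] by simp
    also have "\<dots> = \<i> * of_real (2 * s * E c)"
      unfolding E_def of_real_mult of_real_sum sum_distrib_left by (simp add: algebra_simps)
    finally show "(\<Sum>k\<in>K. of_real (lam k) * (G (circlepath 0 1 x) * \<kappa> k (circlepath 0 1 x)))
      * vector_derivative (circlepath 0 1) (at x within {0..1}) = 2 * of_real pi * \<i> * f x"
      by (simp add: circ vd f_def \<zeta>_def c_def s_def)
  qed
  then have "((\<lambda>x. 1 / (2 * of_real pi * \<i>) * (2 * of_real pi * \<i> * f x)) has_integral
      1 / (2 * of_real pi * \<i>) * (2 * of_real pi * \<i> * S)) {0..1}"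
    by (rule has_integral_mult_right)
  then have "(f has_integral S) {0..1}" by simp
  then have "((\<lambda>x. Re (f x)) has_integral Re S) {0..1}" by (rule has_integral_Re)
  then have "0 \<le> Re S"
  proof (rule has_integral_nonneg)
    fix x :: real
    define c s where "c = cos (2 * pi * x)" and "s = sin (2 * pi * x)"
    define \<zeta> where "\<zeta> = Complex c s"
    have norm: "norm \<zeta> = 1" by (simp add: \<zeta>_def c_def s_def cmod_def)
    have "0 \<le> E c" unfolding E_def by (rule ker) (simp add: c_def)
    moreover have "s * Im (G \<zeta>) \<le> 0"
    proof (cases "0 \<le> s")
      case True
      then show ?thesis using Im[OF norm] by (simp add: \<zeta>_def mult_nonneg_nonpos)
    next
      case False
      then have "Im (G (cnj \<zeta>)) \<le> 0" using norm by (intro Im) (auto simp: \<zeta>_def)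
      then show ?thesis using sym[OF norm] False by (simp add: mult_nonpos_nonneg)
    qed
    moreover have "Re (f x) = - (2 * E c * (s * Im (G \<zeta>)))"
      by (simp add: f_def \<zeta>_def c_def s_def)
    ultimately show "0 \<le> Re (f x)" by (simp add: mult_nonneg_nonpos)
  qed
  then show ?thesis by (simp add: S_def)
qed

text \<open>The dilates \<open>G (\<rho> * \<zeta>)\<close> with \<open>\<rho> < 1\<close> are
  holomorphic on the closed disc. The conclusion involves only finitely many interior points, so it
  survives the limit as \<open>\<rho>\<close> tends to \<open>1\<close>.\<close>

lemma typically_real_combination_ball:
  fixes G :: "complex \<Rightarrow> complex" and w lam :: "'a \<Rightarrow> real"
  assumes holo: "G holomorphic_on ball 0 1"
    and real: "\<And>x. x \<in> \<real> \<Longrightarrow> norm x < 1 \<Longrightarrow> G x \<in> \<real>"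
    and Im: "\<And>\<zeta>. norm \<zeta> < 1 \<Longrightarrow> 0 \<le> Im \<zeta> \<Longrightarrow> Im (G \<zeta>) \<le> 0"
    and K: "finite K" and w: "\<And>k. k \<in> K \<Longrightarrow> \<bar>w k\<bar> < 1"
    and ker: "\<And>c. \<bar>c\<bar> \<le> 1 \<Longrightarrow> 0 \<le> (\<Sum>k\<in>K. lam k * (w k / (1 - 2 * w k * c + (w k)\<^sup>2)))"
  shows "0 \<le> (\<Sum>k\<in>K. lam k * Re (G 0 - G (of_real (w k))))"
proof -
  define \<rho> where "\<rho> n = 1 - 1 / real (n + 2)" for n
  have \<rho>: "0 < \<rho> n" "\<rho> n < 1" for n by (auto simp: \<rho>_def)
  have \<rho>_lim: "\<rho> \<longlonglongrightarrow> 1" unfolding \<rho>_def by real_asymp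
  have "0 \<le> (\<Sum>k\<in>K. lam k * Re (G (of_real (\<rho> n) * 0) - G (of_real (\<rho> n) * of_real (w k))))" for n
  proof (rule typically_real_combination_cball[OF _ _ _ K w ker])
    have small: "norm (of_real (\<rho> n) * \<zeta>) < 1" if "norm \<zeta> \<le> 1" for \<zeta> :: complex
    proof -
      have "norm (of_real (\<rho> n) * \<zeta>) = \<rho> n * norm \<zeta>" using \<rho>[of n] by (simp add: norm_mult)
      also have "\<dots> \<le> \<rho> n * 1" using \<rho>[of n] that by (intro mult_left_mono) auto
      finally show ?thesis using \<rho>[of n] by simp
    qed
    have "G \<circ> (\<lambda>\<zeta>. of_real (\<rho> n) * \<zeta>) holomorphic_on cball 0 1"
      by (intro holomorphic_on_compose holomorphic_intros holomorphic_on_subset[OF holo])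
         (use small in auto)
    then show "(\<lambda>\<zeta>. G (of_real (\<rho> n) * \<zeta>)) holomorphic_on cball 0 1" by (simp add: o_def)
    fix \<zeta> :: complex assume \<zeta>: "norm \<zeta> = 1"
    show "G (of_real (\<rho> n) * cnj \<zeta>) = cnj (G (of_real (\<rho> n) * \<zeta>))"
      using cnj_symmetric_of_real_on_Reals[OF holo real small[of \<zeta>]] \<zeta> by simp
    assume "0 \<le> Im \<zeta>"
    then show "Im (G (of_real (\<rho> n) * \<zeta>)) \<le> 0"
      using \<rho>[of n] small[of \<zeta>] \<zeta> by (intro Im) auto
  qed
  moreover have "(\<lambda>n. \<Sum>k\<in>K. lam k * Re (G (of_real (\<rho> n) * 0) - G (of_real (\<rho> n) * of_real (w k))))
      \<longlonglongrightarrow> (\<Sum>k\<in>K. lam k * Re (G 0 - G (of_real (w k))))"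
  proof -
    have "(\<lambda>n. G (of_real (\<rho> n) * x)) \<longlonglongrightarrow> G x" if "norm x < 1" for x
    proof -
      have "isCont G x"
        using holomorphic_on_imp_continuous_on[OF holo] that
        by (simp add: continuous_on_eq_continuous_at)
      moreover have "(\<lambda>n. of_real (\<rho> n) * x) \<longlonglongrightarrow> of_real 1 * x"
        by (intro tendsto_intros \<rho>_lim)
      ultimately show ?thesis using isCont_tendsto_compose by fastforce
    qed
    note lim = this
    have "(\<lambda>n. G (of_real (\<rho> n) * 0)) \<longlonglongrightarrow> G 0" by simp
    then show ?thesis using w by (intro tendsto_intros lim) auto
  qed
  ultimately show ?thesis by (intro LIMSEQ_le_const) auto
qed

text \<open>The kernel is \<open>x \<mapsto> (x - 1) / ((1 - c) * (x - 1) + 2)\<close> at \<open>x = k + 1\<close>. Up to a positive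
  factor and a constant it is \<open>- 1 / (x + t)\<close> with \<open>t = (1 + c) / (1 - c)\<close>; the value \<open>c = 1\<close> stands for \<open>t = \<infinity>\<close>, which makes
  the parameter range compact.\<close>

lemma stieltjes_combination:
  fixes lam :: "nat \<Rightarrow> real"
  assumes psi: "\<psi> \<in> stieltjes_class"
    and ker: "\<And>c. \<bar>c\<bar> \<le> 1 \<Longrightarrow> 0 \<le> (\<Sum>k\<le>n. lam k * (real k / ((1 - c) * real k + 2)))"
  shows "0 \<le> (\<Sum>k\<le>n. lam k * (Re (\<psi> 1) - Re (\<psi> (of_nat (k + 1)))))"
proof -
  have holo: "\<psi> holomorphic_on - \<real>\<^sub>\<le>\<^sub>0"
    and real: "\<And>x. x > 0 \<Longrightarrow> \<psi> (of_real x) \<in> \<real>"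
    and Im: "\<And>z. z \<notin> \<real>\<^sub>\<le>\<^sub>0 \<Longrightarrow> Im z \<ge> 0 \<Longrightarrow> Im (\<psi> z) \<le> 0"
    using psi by (auto simp: stieltjes_class_def)
  \<comment> \<open>conformal map of the unit disc onto the plane slit along the nonpositive reals, with \<open>T 0 = 1\<close>\<close>
  define T :: "complex \<Rightarrow> complex" where "T \<zeta> = ((1 + \<zeta>) / (1 - \<zeta>))\<^sup>2" for \<zeta>
  have T: "T \<zeta> \<notin> \<real>\<^sub>\<le>\<^sub>0" "0 \<le> Im \<zeta> \<Longrightarrow> 0 \<le> Im (T \<zeta>)" "1 - \<zeta> \<noteq> 0" if "norm \<zeta> < 1" for \<zeta>
  proof -
    \<comment> \<open>The Cayley transform lands in the right half-plane; squaring then avoids the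
      cut and keeps the sign of the imaginary part.\<close>
    define u where "u = (1 + \<zeta>) / (1 - \<zeta>)"
    show nz: "1 - \<zeta> \<noteq> 0" using that by auto
    define N where "N = (1 - Re \<zeta>)\<^sup>2 + (Im \<zeta>)\<^sup>2"
    have N: "0 < N" using nz by (auto simp: N_def complex_eq_iff sum_power2_gt_zero_iff)
    have "(Re \<zeta>)\<^sup>2 + (Im \<zeta>)\<^sup>2 < 1" using that by (simp add: cmod_def)
    moreover have "Re u = (1 - ((Re \<zeta>)\<^sup>2 + (Im \<zeta>)\<^sup>2)) / N"
      by (simp add: u_def Re_divide N_def) (simp add: algebra_simps power2_eq_square)
    ultimately have re: "0 < Re u" using N by simp
    have im: "Im u = 2 * Im \<zeta> / N"
      by (simp add: u_def Im_divide N_def) (simp add: algebra_simps power2_eq_square)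
    have imT: "Im (T \<zeta>) = 2 * Re u * Im u"
      by (simp add: T_def u_def Im_power2)
    have reT: "Re (T \<zeta>) = (Re u)\<^sup>2 - (Im u)\<^sup>2"
      by (simp add: T_def u_def Re_power2)
    show "T \<zeta> \<notin> \<real>\<^sub>\<le>\<^sub>0"
      using re by (auto simp: complex_nonpos_Reals_iff reT imT)
    show "0 \<le> Im (T \<zeta>)" if "0 \<le> Im \<zeta>"
      using that re N by (simp add: imT im)
  qed
  \<comment> \<open>The preimage of \<open>k + 1\<close> under \<open>T\<close>, found by solving
    \<open>(1 + w) / (1 - w) = sqrt (k + 1)\<close>.\<close>
  define w where "w k = (sqrt (real k + 1) - 1) / (sqrt (real k + 1) + 1)" for k
  have w: "\<bar>w k\<bar> < 1" for k
  proof -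
    define u where "u = sqrt (real k + 1)"
    have "1 \<le> u" by (simp add: u_def)
    then show ?thesis unfolding w_def u_def[symmetric] by (simp add: abs_less_iff field_simps)
  qed
  have Tw: "T (of_real (w k)) = of_nat (k + 1)" for k
  proof -
    define u where "u = sqrt (real k + 1)"
    have u: "1 \<le> u" "u\<^sup>2 = real k + 1" by (auto simp: u_def)
    have "(1 + w k) / (1 - w k) = u"
      unfolding w_def u_def[symmetric] using u(1) by (simp add: field_simps)
    then have "((1 + w k) / (1 - w k))\<^sup>2 = real k + 1" by (simp add: u)
    then have "complex_of_real (((1 + w k) / (1 - w k))\<^sup>2) = of_real (real k + 1)" by (rule arg_cong)
    then show ?thesis by (simp add: T_def add.commute)
  qed
  have kernel: "w k / (1 - 2 * w k * c + (w k)\<^sup>2) = (real k / ((1 - c) * real k + 2)) / 2"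
    if "\<bar>c\<bar> \<le> 1" for k c
  proof -
    define u where "u = sqrt (real k + 1)"
    have u: "1 \<le> u" "u\<^sup>2 = real k + 1" by (auto simp: u_def)
    have den: "0 < (1 - c) * real k + 2" using that by (simp add: add_nonneg_pos)
    have arith: "1 - 2 * (b / a) * c + (b / a)\<^sup>2 = (a\<^sup>2 - 2 * c * (a * b) + b\<^sup>2) / a\<^sup>2"
      if "a \<noteq> 0" for a b :: real
      using that by (simp add: field_simps power2_eq_square)
    have "1 - 2 * w k * c + (w k)\<^sup>2 = ((u + 1)\<^sup>2 - 2 * c * ((u + 1) * (u - 1)) + (u - 1)\<^sup>2) / (u + 1)\<^sup>2"
      unfolding w_def u_def[symmetric] using u(1) by (intro arith) simp
    also have "(u + 1)\<^sup>2 - 2 * c * ((u + 1) * (u - 1)) + (u - 1)\<^sup>2 = 2 * u\<^sup>2 + 2 - 2 * c * (u\<^sup>2 - 1)"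
      by (simp add: algebra_simps power2_eq_square)
    also have "\<dots> = 2 * ((1 - c) * real k + 2)" by (simp add: u algebra_simps)
    finally have "w k / (1 - 2 * w k * c + (w k)\<^sup>2)
        = ((u - 1) / (u + 1)) / (2 * ((1 - c) * real k + 2) / (u + 1)\<^sup>2)"
      by (simp add: w_def u_def)
    also have "\<dots> = ((u - 1) * (u + 1)) / (2 * ((1 - c) * real k + 2))"
      using u(1) by (simp add: power2_eq_square)
    also have "(u - 1) * (u + 1) = real k"
      using u(2) by (simp add: algebra_simps power2_eq_square)
    finally show ?thesis by simp
  qed
  have "0 \<le> (\<Sum>k\<in>{..n}. lam k * Re ((\<psi> \<circ> T) 0 - (\<psi> \<circ> T) (of_real (w k))))"
  proof (rule typically_real_combination_ball)
    show "\<psi> \<circ> T holomorphic_on ball 0 1"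
      by (intro holomorphic_on_compose holomorphic_on_subset[OF holo])
         (use T in \<open>auto simp: T_def [abs_def] intro!: holomorphic_intros\<close>)
    show "(\<psi> \<circ> T) x \<in> \<real>" if "x \<in> \<real>" "norm x < 1" for x
    proof -
      obtain a where a: "x = of_real a" using \<open>x \<in> \<real>\<close> by (elim Reals_cases)
      then have "T x = of_real (((1 + a) / (1 - a))\<^sup>2)" by (simp add: T_def)
      moreover have "0 < ((1 + a) / (1 - a))\<^sup>2" using that a by (auto simp: zero_less_power2)
      ultimately show ?thesis using real[of "((1 + a) / (1 - a))\<^sup>2"] by (metis comp_apply)
    qed
    show "Im ((\<psi> \<circ> T) \<zeta>) \<le> 0" if "norm \<zeta> < 1" "0 \<le> Im \<zeta>" for \<zeta>
      using T[OF that(1)] that Im by simp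
    show "0 \<le> (\<Sum>k\<in>{..n}. lam k * (w k / (1 - 2 * w k * c + (w k)\<^sup>2)))" if "\<bar>c\<bar> \<le> 1" for c
    proof -
      have "(\<Sum>k\<in>{..n}. lam k * (w k / (1 - 2 * w k * c + (w k)\<^sup>2)))
          = (\<Sum>k\<le>n. lam k * (real k / ((1 - c) * real k + 2))) / 2"
        by (simp add: kernel[OF that] sum_divide_distrib)
      then show ?thesis using ker[OF that] by simp
    qed
  qed (use w in auto)
  then show ?thesis by (simp add: Tw) (simp add: T_def)
qed

section \<open>Coefficients and values of the multiplier polynomial\<close>

lemma coeff_multiplier_poly: "coeff (multiplier_poly \<psi> P) k = coeff P k * \<psi> (of_nat (k + 1))"
  by (auto simp: multiplier_poly_def coeff_sum coeff_eq_0)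

lemma poly_multiplier_poly:
  "poly (multiplier_poly \<psi> P) z = (\<Sum>k\<le>degree P. coeff P k * \<psi> (of_nat (k + 1)) * z ^ k)"
  by (simp add: multiplier_poly_def poly_sum poly_monom)

section \<open>Resolvent multipliers on rays in the first quadrant\<close>

text \<open>Product rule by induction; \<open>r\<close> may repeat values, which covers multiple
  roots.\<close>

lemma poly_prod_linear_log_deriv:
  fixes r :: "nat \<Rightarrow> complex"
  assumes "\<And>i. i < n \<Longrightarrow> w \<noteq> r i"
  shows "poly (pderiv (\<Prod>i<n. [:- r i, 1:])) w
    = poly (\<Prod>i<n. [:- r i, 1:]) w * (\<Sum>i<n. 1 / (w - r i))"
  using assms
proof (induction n)
  case (Suc n)
  let ?p = "\<Prod>i<n. [:- r i, 1:]"
  have "w - r n \<noteq> 0" using Suc.prems[of n] by simp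
  have arith: "p + p * S * d = (p * d) * (S + 1 / d)" if "d \<noteq> 0" for p S d :: complex
    using that by (simp add: field_simps)
  have "poly (pderiv (\<Prod>i<Suc n. [:- r i, 1:])) w = poly (pderiv (?p * [:- r n, 1:])) w"
    by (simp only: prod.lessThan_Suc)
  also have "\<dots> = poly ?p w + poly (pderiv ?p) w * (w - r n)"
    by (simp only: pderiv_mult) (simp add: pderiv_pCons algebra_simps del: mult_pCons_right)
  also have "poly (pderiv ?p) w = poly ?p w * (\<Sum>i<n. 1 / (w - r i))"
    using Suc by simp
  also have "poly ?p w + poly ?p w * (\<Sum>i<n. 1 / (w - r i)) * (w - r n)
      = (poly ?p w * (w - r n)) * (\<Sum>i<Suc n. 1 / (w - r i))"
    using arith[OF \<open>w - r n \<noteq> 0\<close>] by (simp only: sum.lessThan_Suc)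
  also have "poly ?p w * (w - r n) = poly (\<Prod>i<Suc n. [:- r i, 1:]) w"
    by (simp add: algebra_simps)
  finally show ?case .
qed simp

text \<open>Controls one summand of the logarithmic derivative. With \<open>x = -a\<close>,
  multiplying by the conjugate denominator leaves numerators
  \<open>s * (norm z)^2 + a * Re z\<close> and \<open>a * Im z\<close>. At \<open>s = 0\<close> the
  first may vanish, since \<open>Re z = 0\<close> is allowed.\<close>

lemma Re_Im_div_shifted:
  fixes z x :: complex and s :: real
  assumes z: "0 \<le> Re z" "0 < Im z" and x: "x \<in> \<real>" "Re x < 0" and s: "0 \<le> s"
  defines "\<zeta> \<equiv> z / (of_real s * z - x)"
  shows "of_real s * z - x \<noteq> 0" "0 \<le> Re \<zeta>" "0 < s \<Longrightarrow> 0 < Re \<zeta>" "0 < Im \<zeta>"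
proof -
  define a where "a = - Re x"
  have x_eq: "x = - of_real a" and a: "0 < a"
    using x by (auto simp: a_def complex_eq_iff elim: Reals_cases)
  define N where "N = (s * Re z + a)\<^sup>2 + (s * Im z)\<^sup>2"
  have pos: "0 < s * Re z + a" using z s a by (simp add: add_nonneg_pos)
  then have N: "0 < N" by (simp add: N_def add_pos_nonneg)
  show "of_real s * z - x \<noteq> 0"
    using pos by (auto simp: x_eq complex_eq_iff)
  have re: "Re \<zeta> = (s * ((Re z)\<^sup>2 + (Im z)\<^sup>2) + a * Re z) / N"
    by (simp add: \<zeta>_def x_eq Re_divide N_def) (simp add: algebra_simps power2_eq_square)
  have im: "Im \<zeta> = a * Im z / N"
    by (simp add: \<zeta>_def x_eq Im_divide N_def) (simp add: algebra_simps power2_eq_square)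
  have "0 < (Re z)\<^sup>2 + (Im z)\<^sup>2" using z by (simp add: add_nonneg_pos)
  then show "0 \<le> Re \<zeta>" "0 < s \<Longrightarrow> 0 < Re \<zeta>"
    using s a z N by (auto simp: re intro!: divide_nonneg_pos divide_pos_pos add_nonneg_nonneg add_pos_nonneg)
  show "0 < Im \<zeta>" using a z N by (simp add: im)
qed

lemma neg_real_roots_factorization:
  fixes P :: "complex poly"
  assumes "\<And>z. poly P z = 0 \<Longrightarrow> z \<in> \<real> \<and> Re z < 0"
  obtains c r where "c \<noteq> 0" "P = smult c (\<Prod>i<degree P. [:- r i, 1:])"
    "\<And>i. i < degree P \<Longrightarrow> r i \<in> \<real> \<and> Re (r i) < 0"
proof -
  obtain r where r: "smult (lead_coeff P) (\<Prod>i<degree P. [:- r i, 1:]) = P"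
    using complex_poly_decompose' by blast
  \<comment> \<open>The zero polynomial would have the root \<open>0\<close>, which is not
    negative.\<close>
  have "P \<noteq> 0" using assms[of 0] by auto
  show ?thesis
  proof (rule that[of "lead_coeff P" r])
    show "lead_coeff P \<noteq> 0" using \<open>P \<noteq> 0\<close> by simp
    show "P = smult (lead_coeff P) (\<Prod>i<degree P. [:- r i, 1:])" using r by simp
    show "r i \<in> \<real> \<and> Re (r i) < 0" if "i < degree P" for i
    proof (rule assms)
      have "poly (\<Prod>i<degree P. [:- r i, 1:]) (r i) = 0"
        using that by (auto simp: poly_prod)
      then show "poly P (r i) = 0" using arg_cong[OF r, of "\<lambda>p. poly p (r i)"] by simp
    qed
  qed
qed

text \<open>The product is \<open>(norm x)^2 * cnj (y / x)\<close>. The convention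
  \<open>y / 0 = 0\<close> lets the hypothesis exclude \<open>x = 0\<close>.\<close>

lemma Im_mult_cnj_pos:
  assumes "Im (y / x) < 0"
  shows "0 < Im (x * cnj y)"
proof -
  have Im_eq: "Im (of_real a * cnj v) = a * (- Im v)" for a v by simp
  have "x \<noteq> 0" using assms by auto
  then have "x * cnj y = (x * cnj x) * cnj (y / x)" by simp
  then have "x * cnj y = of_real ((norm x)\<^sup>2) * cnj (y / x)"
    by (simp only: complex_norm_square)
  then have "Im (x * cnj y) = (norm x)\<^sup>2 * (- Im (y / x))"
    by (simp only: Im_eq)
  moreover have "0 < (norm x)\<^sup>2 * (- Im (y / x))"
    using assms \<open>x \<noteq> 0\<close> by (intro mult_pos_pos) auto
  ultimately show ?thesis by simp
qed

section \<open>A fixed ray: logarithmic derivative and the linear equation for the quotient\<close>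

context
  fixes P :: "complex poly" and z :: complex
  assumes roots: "\<And>z. poly P z = 0 \<Longrightarrow> z \<in> \<real> \<and> Re z < 0"
    and degree: "0 < degree P"
    and z: "0 \<le> Re z" "0 < Im z"
begin

lemma poly_nonzero_ray: "0 \<le> s \<Longrightarrow> poly P (of_real s * z) \<noteq> 0"
  using roots[of "of_real s * z"] z by (auto simp: mult_less_0_iff)

text \<open>Here \<open>l\<close> is the sum of \<open>e i \<zeta> = z / (\<zeta> * z - r i)\<close>
  over the roots, with derivative the sum of \<open>- (e i \<zeta>)^2\<close>. Each
  \<open>e i\<close> lies in the closed first quadrant, so its square has nonnegative imaginary
  part; positive degree makes the sums nonempty.\<close>

lemma log_deriv_ray:
  obtains l l' :: "complex \<Rightarrow> complex" where
    "\<And>s. 0 \<le> s \<Longrightarrow> z * poly (pderiv P) (of_real s * z) = poly P (of_real s * z) * l (of_real s)"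
    "\<And>s. 0 \<le> s \<Longrightarrow> (l has_field_derivative l' (of_real s)) (at (of_real s))"
    "\<And>s. 0 < s \<Longrightarrow> 0 < Re (l (of_real s))"
    "\<And>s. 0 \<le> s \<Longrightarrow> 0 < Im (l (of_real s))"
    "\<And>s. 0 \<le> s \<Longrightarrow> Im (l' (of_real s)) \<le> 0"
proof -
  obtain c r where P: "P = smult c (\<Prod>i<degree P. [:- r i, 1:])"
    and r: "\<And>i. i < degree P \<Longrightarrow> r i \<in> \<real> \<and> Re (r i) < 0"
    using neg_real_roots_factorization[OF roots] by blast
  define n where "n = degree P"
  define e where "e i \<zeta> = z / (\<zeta> * z - r i)" for i :: nat and \<zeta> :: complex
  have e: "of_real s * z - r i \<noteq> 0" "0 \<le> Re (e i (of_real s))"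
      "0 < s \<Longrightarrow> 0 < Re (e i (of_real s))" "0 < Im (e i (of_real s))"
    if "i < n" "0 \<le> s" for i s
    using Re_Im_div_shifted[OF z, of "r i" s] r[of i] that by (auto simp: n_def e_def)
  have n: "0 < n" using degree by (simp add: n_def)
  show ?thesis
  proof (rule that[of "\<lambda>\<zeta>. \<Sum>i<n. e i \<zeta>" "\<lambda>\<zeta>. \<Sum>i<n. - (e i \<zeta>)\<^sup>2"])
    fix s :: real assume s: "0 \<le> s"
    have "poly (pderiv P) (of_real s * z) = poly P (of_real s * z) * (\<Sum>i<n. 1 / (of_real s * z - r i))"
    proof -
      have "poly (pderiv (\<Prod>i<n. [:- r i, 1:])) (of_real s * z)
          = poly (\<Prod>i<n. [:- r i, 1:]) (of_real s * z) * (\<Sum>i<n. 1 / (of_real s * z - r i))"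
        by (rule poly_prod_linear_log_deriv) (use e s in force)
      then show ?thesis unfolding n_def
        by (subst (1 2) P) (simp add: pderiv_smult)
    qed
    then show "z * poly (pderiv P) (of_real s * z) = poly P (of_real s * z) * (\<Sum>i<n. e i (of_real s))"
      by (simp add: e_def sum_distrib_left algebra_simps)
    show "((\<lambda>\<zeta>. \<Sum>i<n. e i \<zeta>) has_field_derivative (\<Sum>i<n. - (e i (of_real s))\<^sup>2)) (at (of_real s))"
      unfolding e_def using e(1)[OF _ s]
      by (intro DERIV_sum) (auto intro!: derivative_eq_intros simp: power2_eq_square)
    show "0 < Im (\<Sum>i<n. e i (of_real s))"
      using e(4)[OF _ s] n by (auto simp: Im_sum intro!: sum_pos)
    show "Im (\<Sum>i<n. - (e i (of_real s))\<^sup>2) \<le> 0"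
    proof -
      have "0 \<le> (\<Sum>i<n. Im ((e i (of_real s))\<^sup>2))"
        using e(2,4)[OF _ s] by (intro sum_nonneg) (simp add: Im_power2 less_imp_le)
      then show ?thesis by (simp add: sum_negf)
    qed
  next
    fix s :: real assume "0 < s"
    then show "0 < Re (\<Sum>i<n. e i (of_real s))"
      using e(3)[of _ s] n by (auto simp: Re_sum intro!: sum_pos)
  qed
qed

text \<open>The quantity is \<open>- (norm (P z))^2 * Im (l 1)\<close>. It handles the limiting
  resolvent \<open>t = \<infinity>\<close>.\<close>

lemma Im_mult_cnj_pderiv_neg: "Im (poly P z * cnj (z * poly (pderiv P) z)) < 0"
proof -
  obtain l :: "complex \<Rightarrow> complex" where "\<And>s. 0 \<le> s \<Longrightarrow> z * poly (pderiv P) (of_real s * z) = poly P (of_real s * z) * l (of_real s)"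
    and im: "\<And>s. 0 \<le> s \<Longrightarrow> 0 < Im (l (of_real s))"
    by (rule log_deriv_ray) (rule that)
  from this(1)[of 1] have "z * poly (pderiv P) z = poly P z * l 1" by simp
  then have "poly P z * cnj (z * poly (pderiv P) z) = (poly P z * cnj (poly P z)) * cnj (l 1)"
    by (simp only: complex_cnj_mult mult.assoc)
  then have "poly P z * cnj (z * poly (pderiv P) z) = of_real ((norm (poly P z))\<^sup>2) * cnj (l 1)"
    by (simp only: complex_norm_square)
  then have "Im (poly P z * cnj (z * poly (pderiv P) z)) = Im (of_real ((norm (poly P z))\<^sup>2) * cnj (l 1))"
    by (rule arg_cong)
  also have "\<dots> = - ((norm (poly P z))\<^sup>2 * Im (l 1))" by simp
  also have "\<dots> < 0" using im[of 1] poly_nonzero_ray[of 1] by simp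
  finally show ?thesis .
qed

lemma Im_resolvent_multiplier_pos:
  assumes t: "0 \<le> t"
  shows "0 < Im (poly P z * cnj (poly (multiplier_poly (\<lambda>x. 1 / (x + of_real t)) P) z))"
proof -
  define Q where "Q = multiplier_poly (\<lambda>x. 1 / (x + of_real t)) P"
  have nz: "of_nat (k + 1) + of_real t \<noteq> (0::complex)" for k
    using t by (auto simp: complex_eq_iff)
  \<comment> \<open>The operator \<open>w * d/dw + (1 + t)\<close> multiplies the coefficient of
    index \<open>k\<close> by \<open>k + 1 + t\<close>, undoing the resolvent multiplier. Dividing
    by \<open>P\<close> along the ray yields the equation for \<open>u\<close>.\<close>
  have Q_eq: "pCons 0 (pderiv Q) + smult (1 + of_real t) Q = P"
  proof (rule poly_eqI)
    fix k
    have "coeff (pCons 0 (pderiv Q)) k = of_nat k * coeff Q k"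
      by (cases k) (simp_all add: coeff_pderiv)
    then have "coeff (pCons 0 (pderiv Q) + smult (1 + of_real t) Q) k = (of_nat (k + 1) + of_real t) * coeff Q k"
      by (simp add: algebra_simps)
    also have "\<dots> = coeff P k"
      using nz[of k] by (simp only: Q_def coeff_multiplier_poly)
        (simp only: times_divide_eq_right mult_1_right nonzero_mult_div_cancel_left not_False_eq_True)
    finally show "coeff (pCons 0 (pderiv Q) + smult (1 + of_real t) Q) k = coeff P k" .
  qed
  have Q_ode: "w * poly (pderiv Q) w + (1 + of_real t) * poly Q w = poly P w" for w
    using arg_cong[OF Q_eq, of "\<lambda>p. poly p w"] by simp
  obtain l l' :: "complex \<Rightarrow> complex" where
    l: "\<And>s. 0 \<le> s \<Longrightarrow> z * poly (pderiv P) (of_real s * z) = poly P (of_real s * z) * l (of_real s)" and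
    dl: "\<And>s. 0 \<le> s \<Longrightarrow> (l has_field_derivative l' (of_real s)) (at (of_real s))" and
    Re_l: "\<And>s. 0 < s \<Longrightarrow> 0 < Re (l (of_real s))" and
    Im_l: "\<And>s. 0 \<le> s \<Longrightarrow> 0 < Im (l (of_real s))" and
    Im_l': "\<And>s. 0 \<le> s \<Longrightarrow> Im (l' (of_real s)) \<le> 0"
    by (rule log_deriv_ray) (rule that)
  define u where "u \<zeta> = poly Q (\<zeta> * z) / poly P (\<zeta> * z)" for \<zeta>
  define u' where "u' \<zeta> = z * poly (pderiv Q) (\<zeta> * z) / poly P (\<zeta> * z) - u \<zeta> * l \<zeta>" for \<zeta>
  have du: "(u has_field_derivative u' (of_real s)) (at (of_real s))" if "0 \<le> s" for s
  proof -
    have arith: "(z * a * p - q * (p * L)) / (p * p) = z * a / p - q / p * L" if "p \<noteq> 0" for a p q L :: complex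
      using that by (simp add: field_simps)
    have dp: "((\<lambda>\<zeta>. poly p (\<zeta> * z)) has_field_derivative z * poly (pderiv p) (of_real s * z)) (at (of_real s))" for p
    proof -
      have "((\<lambda>\<zeta>. \<zeta> * z) has_field_derivative z) (at (of_real s))"
        by (auto intro!: derivative_eq_intros)
      from DERIV_chain2[OF poly_DERIV this] show ?thesis by (simp add: mult.commute)
    qed
    have "(u has_field_derivative
        (z * poly (pderiv Q) (of_real s * z) * poly P (of_real s * z)
          - poly Q (of_real s * z) * (z * poly (pderiv P) (of_real s * z)))
        / (poly P (of_real s * z) * poly P (of_real s * z))) (at (of_real s))"
      unfolding u_def by (rule DERIV_divide[OF dp dp poly_nonzero_ray[OF that]])
    then show ?thesis
      unfolding l[OF that] arith[OF poly_nonzero_ray[OF that]] by (simp add: u'_def u_def)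
  qed
  have u_ode: "of_real s * u' (of_real s) = 1 - (1 + of_real t) * u (of_real s) - of_real s * (l (of_real s) * u (of_real s))"
    if "0 \<le> s" for s
  proof -
    have "of_real s * u' (of_real s) = (of_real s * z * poly (pderiv Q) (of_real s * z)) / poly P (of_real s * z)
        - of_real s * (l (of_real s) * u (of_real s))"
      by (simp add: u'_def algebra_simps)
    also have "of_real s * z * poly (pderiv Q) (of_real s * z)
        = poly P (of_real s * z) - (1 + of_real t) * poly Q (of_real s * z)"
      using Q_ode[of "of_real s * z"] by (simp add: algebra_simps)
    also have "\<dots> / poly P (of_real s * z) = 1 - (1 + of_real t) * u (of_real s)"
      using poly_nonzero_ray[OF that] by (simp add: u_def diff_divide_distrib)
    finally show ?thesis .
  qed
  have dRe: "((\<lambda>s. Re (f (of_real s))) has_real_derivative Re f') (at s)"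
    and dIm: "((\<lambda>s. Im (f (of_real s))) has_real_derivative Im f') (at s)"
    if "(f has_field_derivative f') (at (of_real s))" for f f' s
    using has_field_derivative_Re[OF has_vector_derivative_real_field[OF that]]
      has_field_derivative_Im[OF has_vector_derivative_real_field[OF that]] by simp_all
  have cont: "continuous_on {0..1} (\<lambda>s. Re (l (of_real s)))"
    by (rule DERIV_atLeastAtMost_imp_continuous_on) (use dRe[OF dl] in blast)
  have ode_Re: "s * Re (u' (of_real s)) = 1 - (1 + t) * Re (u (of_real s))
      - s * (Re (l (of_real s)) * Re (u (of_real s)) - Im (l (of_real s)) * Im (u (of_real s)))"
    and ode_Im: "s * Im (u' (of_real s)) = - ((1 + t) * Im (u (of_real s)))
      - s * (Re (l (of_real s)) * Im (u (of_real s)) + Im (l (of_real s)) * Re (u (of_real s)))"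
    if "0 \<le> s" for s
    using u_ode[OF that] by (simp_all add: complex_eq_iff)
  have "Im (u (of_real 1)) < 0"
    by (rule planar_comparison[where p = "\<lambda>s. Re (u (of_real s))" and q = "\<lambda>s. Im (u (of_real s))"
        and A = "\<lambda>s. Re (l (of_real s))" and B = "\<lambda>s. Im (l (of_real s))"
        and p' = "\<lambda>s. Re (u' (of_real s))" and q' = "\<lambda>s. Im (u' (of_real s))"
        and B' = "\<lambda>s. Im (l' (of_real s))",
        OF t dRe[OF du] dIm[OF du] dIm[OF dl] ode_Re ode_Im Re_l cont Im_l Im_l'])
  then have "Im (poly Q z / poly P z) < 0" by (simp only: u_def of_real_1 mult_1_left)
  then show ?thesis unfolding Q_def by (rule Im_mult_cnj_pos)
qed

end

section \<open>Stability\<close>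

lemma Im_mult_cnj_multiplier_poly:
  assumes "\<And>k. \<psi> (of_nat (k + 1)) = of_real (f k)"
  shows "Im (x * cnj (poly (multiplier_poly \<psi> P) z))
    = (\<Sum>k\<le>degree P. Im (x * cnj (coeff P k * z ^ k)) * f k)"
  unfolding poly_multiplier_poly assms cnj_sum sum_distrib_left Im_sum
  by (intro sum.cong) (simp_all add: algebra_simps)

lemma stieltjes_class_of_nat:
  assumes "\<psi> \<in> stieltjes_class"
  shows "\<psi> (of_nat (k + 1)) = of_real (Re (\<psi> (of_nat (k + 1))))" "0 < Re (\<psi> (of_nat (k + 1)))"
proof -
  have "0 < real (k + 1)" by simp
  then have "\<psi> (of_real (real (k + 1))) \<in> \<real>" "0 < Re (\<psi> (of_real (real (k + 1))))"
    using assms unfolding stieltjes_class_def by blast+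
  then show "\<psi> (of_nat (k + 1)) = of_real (Re (\<psi> (of_nat (k + 1))))" "0 < Re (\<psi> (of_nat (k + 1)))"
    unfolding of_real_of_nat_eq by simp_all
qed

text \<open>A zero makes the functional vanish at \<open>\<psi>\<close>. Its uniform positivity on
  the compact family of kernels leaves room to perturb the weights at any index \<open>j\<close>,
  which forces \<open>\<psi>\<close> to be constant on the nodes; then the value is a positive
  multiple of \<open>poly P z\<close>.\<close>

lemma multiplier_poly_nonzero_quadrant:
  fixes P :: "complex poly"
  assumes roots: "\<And>z. poly P z = 0 \<Longrightarrow> z \<in> \<real> \<and> Re z < 0"
    and degree: "0 < degree P"
    and z: "0 \<le> Re z" "0 < Im z"
    and psi: "\<psi> \<in> stieltjes_class"
  shows "poly (multiplier_poly \<psi> P) z \<noteq> 0"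
proof
  assume zero: "poly (multiplier_poly \<psi> P) z = 0"
  define n where "n = degree P"
  define g where "g k = Re (\<psi> (of_nat (k + 1)))" for k
  have psi_real: "\<psi> (of_nat (k + 1)) = of_real (g k)" and g_pos: "0 < g k" for k
    using stieltjes_class_of_nat[OF psi, of k] by (auto simp: g_def)
  define L where "L k = Im (poly P z * cnj (coeff P k * z ^ k))" for k
  have sum_L: "Im (poly P z * cnj (poly (multiplier_poly \<phi> P) z)) = (\<Sum>k\<le>n. L k * f k)"
    if "\<And>k. \<phi> (of_nat (k + 1)) = of_real (f k)" for \<phi> f
    unfolding L_def n_def by (rule Im_mult_cnj_multiplier_poly, rule that)
  have L0: "(\<Sum>k\<le>n. L k) = 0"
  proof -
    have "multiplier_poly (\<lambda>_. 1) P = P" by (rule poly_eqI) (simp add: coeff_multiplier_poly)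
    then have "(\<Sum>k\<le>n. L k * 1) = Im (poly P z * cnj (poly P z))"
      using sum_L[of "\<lambda>_. 1" "\<lambda>_. 1"] by simp
    then show ?thesis by (simp add: complex_mult_cnj)
  qed
  have L_deriv: "(\<Sum>k\<le>n. L k * real k) < 0"
  proof -
    \<comment> \<open>Nodes are shifted by one: at \<open>x = k + 1\<close> the multiplier
      \<open>x - 1\<close> is \<open>k\<close>.\<close>
    have "multiplier_poly (\<lambda>x. x - 1) P = pCons 0 (pderiv P)"
    proof (rule poly_eqI)
      show "coeff (multiplier_poly (\<lambda>x. x - 1) P) k = coeff (pCons 0 (pderiv P)) k" for k
        by (cases k) (simp_all add: coeff_multiplier_poly coeff_pderiv)
    qed
    then have "(\<Sum>k\<le>n. L k * real k) = Im (poly P z * cnj (z * poly (pderiv P) z))"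
      using sum_L[of "\<lambda>x. x - 1" real] by simp
    then show ?thesis using Im_mult_cnj_pderiv_neg[OF roots degree z] by simp
  qed
  have L_resolvent: "0 < (\<Sum>k\<le>n. L k * (1 / (real (k + 1) + t)))" if "0 \<le> t" for t
    using Im_resolvent_multiplier_pos[OF roots degree z that]
      sum_L[of "\<lambda>x. 1 / (x + of_real t)" "\<lambda>k. 1 / (real (k + 1) + t)"]
    by simp
  define T where "T c = (\<Sum>k\<le>n. - L k * (real k / ((1 - c) * real k + 2)))" for c
  have den: "0 < (1 - c) * real k + 2" if "\<bar>c\<bar> \<le> 1" for c :: real and k
    using that by (simp add: add_nonneg_pos)
  have T_pos: "0 < T c" if c: "\<bar>c\<bar> \<le> 1" for c
  proof (cases "c = 1")
    case True
    have "T c = - (\<Sum>k\<le>n. L k * real k) / 2"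
      by (simp add: T_def True sum_negf sum_divide_distrib)
    then show ?thesis using L_deriv by simp
  next
    case False
    define t where "t = (1 + c) / (1 - c)"
    have t: "0 \<le> t" using c False by (simp add: t_def)
    have d: "0 < 1 - c" using c False by simp
    \<comment> \<open>Partial fractions, using \<open>1 + t = 2 / (1 - c)\<close>. The constant part
      disappears after summation by \<open>L0\<close>.\<close>
    have "- L k * (real k / ((1 - c) * real k + 2))
        = 2 / (1 - c)\<^sup>2 * (L k * (1 / (real (k + 1) + t))) - L k / (1 - c)" for k
    proof -
      have arith: "- l * (x / D) = 2 / d\<^sup>2 * (l * (1 / (D / d))) - l / d"
        if "d \<noteq> 0" "D \<noteq> 0" "D = d * x + 2" for l x D d :: real
        using that(1,2) by (simp add: field_simps power2_eq_square) (simp add: that(3) algebra_simps)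
      have "real (k + 1) + t = ((1 - c) * real k + 2) / (1 - c)"
        using d by (simp add: t_def field_simps)
      then show ?thesis using arith[of "1 - c" "(1 - c) * real k + 2" "real k" "L k"] d den[OF c, of k] by simp
    qed
    then have "T c = 2 / (1 - c)\<^sup>2 * (\<Sum>k\<le>n. L k * (1 / (real (k + 1) + t))) - (\<Sum>k\<le>n. L k) / (1 - c)"
      by (simp only: T_def sum_subtractf sum_distrib_left sum_divide_distrib)
    then show ?thesis using L_resolvent[OF t] d by (simp add: L0)
  qed
  obtain \<delta> where \<delta>: "0 < \<delta>" and T_ge: "\<And>c. \<bar>c\<bar> \<le> 1 \<Longrightarrow> \<delta> \<le> T c"
  proof -
    have "continuous_on {-1..1} T"
      unfolding T_def
    proof (intro continuous_intros ballI)
      show "(1 - c) * real k + 2 \<noteq> 0" if "c \<in> {-1..1}" for c k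
        using den[of c k] that by (simp add: abs_le_iff)
    qed
    then obtain c0 where c0: "c0 \<in> {-1..1}" "\<And>c. c \<in> {-1..1} \<Longrightarrow> T c0 \<le> T c"
      using continuous_attains_inf[of "{-1..1::real}" T] by auto
    show ?thesis
      by (rule that[of "T c0"]) (use c0 T_pos in \<open>auto simp: abs_le_iff\<close>)
  qed
  have g_const: "g j = g 0" if j: "j \<le> n" for j
  proof -
    have comb: "0 \<le> (\<Sum>k\<le>n. lam k * (g 0 - g k))"
      if "\<And>c. \<bar>c\<bar> \<le> 1 \<Longrightarrow> 0 \<le> (\<Sum>k\<le>n. lam k * (real k / ((1 - c) * real k + 2)))" for lam
      using stieltjes_combination[OF psi that] by (simp add: g_def)
    \<comment> \<open>Each kernel at \<open>j\<close> is at most \<open>j / 2\<close>, so this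
      perturbation costs at most \<open>\<delta>\<close>; the \<open>+ 1\<close> covers
      \<open>j = 0\<close>.\<close>
    define \<epsilon> where "\<epsilon> = 2 * \<delta> / (real j + 1)"
    have \<epsilon>: "0 < \<epsilon>" using \<delta> by (simp add: \<epsilon>_def)
    \<comment> \<open>The unit weight at \<open>j\<close> gives \<open>g j \<le> g 0\<close>; the
      perturbed weights below give the opposite inequality.\<close>
    have "0 \<le> (\<Sum>k\<le>n. (if k = j then 1 else 0) * (g 0 - g k))"
      by (rule comb, rule sum_nonneg) (use den in \<open>auto intro!: divide_nonneg_pos\<close>)
    also have "(\<Sum>k\<le>n. (if k = j then 1 else 0) * (g 0 - g k)) = (\<Sum>k\<le>n. if k = j then g 0 - g k else 0)"
      by (intro sum.cong) auto
    finally have "0 \<le> g 0 - g j" using j by simp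
    moreover have "0 \<le> (\<Sum>k\<le>n. (- L k - \<epsilon> * (if k = j then 1 else 0)) * (g 0 - g k))"
    proof (rule comb)
      fix c :: real assume c: "\<bar>c\<bar> \<le> 1"
      have "real j / ((1 - c) * real j + 2) \<le> real j / 2"
        using c by (intro divide_left_mono) (auto simp: add_nonneg_pos)
      then have "\<epsilon> * (real j / ((1 - c) * real j + 2)) \<le> \<epsilon> * (real j / 2)"
        using \<epsilon> by (intro mult_left_mono) auto
      also have "\<dots> \<le> \<delta>" using \<delta> by (simp add: \<epsilon>_def field_simps)
      also have "\<dots> \<le> T c" by (rule T_ge[OF c])
      also have "T c - \<epsilon> * (real j / ((1 - c) * real j + 2))
          = (\<Sum>k\<le>n. (- L k - \<epsilon> * (if k = j then 1 else 0)) * (real k / ((1 - c) * real k + 2)))"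
      proof -
        have "(- L k - \<epsilon> * (if k = j then 1 else 0)) * x = - L k * x - (if k = j then \<epsilon> * x else 0)" for k x
          by (cases "k = j") (simp_all add: left_diff_distrib)
        then have "(\<Sum>k\<le>n. (- L k - \<epsilon> * (if k = j then 1 else 0)) * (real k / ((1 - c) * real k + 2)))
            = T c - (\<Sum>k\<le>n. if k = j then \<epsilon> * (real k / ((1 - c) * real k + 2)) else 0)"
          by (simp only: T_def sum_subtractf)
        then show ?thesis using j by simp
      qed
      finally show "0 \<le> (\<Sum>k\<le>n. (- L k - \<epsilon> * (if k = j then 1 else 0)) * (real k / ((1 - c) * real k + 2)))"
        by simp
    qed
    moreover have "(\<Sum>k\<le>n. (- L k - \<epsilon> * (if k = j then 1 else 0)) * (g 0 - g k)) = - (\<epsilon> * (g 0 - g j))"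
    proof -
      have "(- L k - \<epsilon> * (if k = j then 1 else 0)) * (g 0 - g k)
          = L k * g k - g 0 * L k - (if k = j then \<epsilon> * (g 0 - g k) else 0)" for k
        by (cases "k = j") (simp_all add: algebra_simps)
      then have "(\<Sum>k\<le>n. (- L k - \<epsilon> * (if k = j then 1 else 0)) * (g 0 - g k))
          = (\<Sum>k\<le>n. L k * g k) - g 0 * (\<Sum>k\<le>n. L k) - (\<Sum>k\<le>n. if k = j then \<epsilon> * (g 0 - g k) else 0)"
        by (simp only: sum_subtractf sum_distrib_left)
      moreover have "(\<Sum>k\<le>n. L k * g k) = 0" using sum_L[of \<psi> g, OF psi_real] zero by simp
      ultimately show ?thesis using j L0 by simp
    qed
    ultimately show ?thesis using \<epsilon> by (auto simp: mult_le_0_iff)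
  qed
  have "poly (multiplier_poly \<psi> P) z = of_real (g 0) * poly P z"
  proof -
    have "coeff P k * \<psi> (of_nat (k + 1)) * z ^ k = of_real (g 0) * (coeff P k * z ^ k)"
      if "k \<le> degree P" for k
      using psi_real[of k] g_const[of k] that by (simp add: n_def)
    then show ?thesis
      unfolding poly_multiplier_poly poly_altdef[of P] sum_distrib_left by (intro sum.cong) auto
  qed
  moreover have "poly P z \<noteq> 0" using roots[of z] z by auto
  ultimately show False using zero g_pos[of 0] by simp
qed

text \<open>Up to the leading coefficient, \<open>P\<close> has nonnegative coefficients and a
  positive constant term, and positive multipliers preserve this.\<close>

lemma multiplier_poly_nonzero_nonneg_real:
  fixes P :: "complex poly"
  assumes roots: "\<And>z. poly P z = 0 \<Longrightarrow> z \<in> \<real> \<and> Re z < 0"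
    and psi: "\<And>k. \<psi> (of_nat (k + 1)) = of_real (g k)" "\<And>k. 0 < g k"
    and x: "0 \<le> x"
  shows "poly (multiplier_poly \<psi> P) (of_real x) \<noteq> 0"
proof -
  obtain c r where c: "c \<noteq> 0" and P: "P = smult c (\<Prod>i<degree P. [:- r i, 1:])"
    and r: "\<And>i. i < degree P \<Longrightarrow> r i \<in> \<real> \<and> Re (r i) < 0"
    using neg_real_roots_factorization[OF roots] by blast
  have sum_closed: "(\<Sum>i\<in>A. f i) \<in> \<real>\<^sub>\<ge>\<^sub>0"
    if "finite A" "\<And>i. i \<in> A \<Longrightarrow> f i \<in> \<real>\<^sub>\<ge>\<^sub>0" for A and f :: "nat \<Rightarrow> complex"
    using that by (induction A rule: finite_induct) auto
  have coeffs: "coeff (\<Prod>i<m. [:- r i, 1:]) k \<in> \<real>\<^sub>\<ge>\<^sub>0" if "m \<le> degree P" for m k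
    using that
  proof (induction m arbitrary: k)
    case (Suc m)
    have "- r m \<in> \<real>\<^sub>\<ge>\<^sub>0" using r[of m] Suc.prems by (auto simp: complex_nonneg_Reals_iff complex_is_Real_iff)
    then have "coeff [:- r m, 1:] i \<in> \<real>\<^sub>\<ge>\<^sub>0" for i by (cases i) (auto simp: coeff_pCons split: nat.split)
    then show ?case
      using Suc by (simp only: prod.lessThan_Suc coeff_mult)
         (auto intro!: sum_closed nonneg_Reals_mult_I)
  qed (auto simp: coeff_1)
  define R where "R = (\<Prod>i<degree P. [:- r i, 1:])"
  have PR: "coeff P k = c * coeff R k" for k by (subst P) (simp add: R_def)
  define a where "a k = Re (coeff R k)" for k
  have a: "coeff R k = of_real (a k)" "0 \<le> a k" for k
    using coeffs[of "degree P" k] by (auto simp: R_def a_def complex_nonneg_Reals_iff complex_eq_iff)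
  have "coeff P 0 \<noteq> 0" using roots[of 0] by (auto simp: poly_0_coeff_0)
  then have a0: "0 < a 0" using a(2)[of 0] by (simp add: PR a less_le)
  have "poly (multiplier_poly \<psi> P) (of_real x) = c * of_real (\<Sum>k\<le>degree P. a k * g k * x ^ k)"
    unfolding poly_multiplier_poly PR a(1) psi(1) by (simp add: sum_distrib_left mult_ac)
  moreover have "0 < (\<Sum>k\<le>degree P. a k * g k * x ^ k)"
    \<comment> \<open>The term \<open>k = 0\<close> is strictly positive even at
      \<open>x = 0\<close>, because \<open>0 ^ 0 = 1\<close>.\<close>
    by (rule sum_pos2[of _ 0]) (use a a0 psi(2) x in \<open>auto intro!: mult_nonneg_nonneg simp: less_imp_le\<close>)
  ultimately show ?thesis using c by (simp del: of_real_sum)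
qed

theorem mainTheorem3:
  fixes P :: "complex poly" and \<psi> :: "complex \<Rightarrow> complex"
  assumes roots: "\<And>z. poly P z = 0 \<Longrightarrow> z \<in> \<real> \<and> Re z < 0"
    and psi: "\<psi> \<in> stieltjes_class"
  shows "stable_poly (multiplier_poly \<psi> P)"
  unfolding stable_poly_def
proof (intro allI impI, rule ccontr)
  fix z assume zero: "poly (multiplier_poly \<psi> P) z = 0" and "\<not> Re z < 0"
  then have z: "0 \<le> Re z" by simp
  define g where "g k = Re (\<psi> (of_nat (k + 1)))" for k
  have psi_real: "\<psi> (of_nat (k + 1)) = of_real (g k)" and g_pos: "0 < g k" for k
    using stieltjes_class_of_nat[OF psi, of k] by (auto simp: g_def)
  show False
  proof (cases "degree P = 0 \<or> Im z = 0")
    case True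
    \<comment> \<open>For constant \<open>P\<close> the multiplier polynomial is constant, so a zero
      anywhere moves to \<open>Re z\<close>.\<close>
    have "poly (multiplier_poly \<psi> P) (of_real (Re z)) = 0"
    proof (cases "Im z = 0")
      case True
      then have "of_real (Re z) = z" by (simp add: complex_eq_iff)
      then show ?thesis using zero by simp
    next
      case False
      then have "degree P = 0" using True by simp
      then show ?thesis using zero by (simp add: poly_multiplier_poly)
    qed
    then show False
      using multiplier_poly_nonzero_nonneg_real[of P \<psi> g "Re z", OF roots psi_real g_pos z] by simp
  next
    case False
    then have degree: "0 < degree P" by simp
    show False
    proof (cases "0 < Im z")
      case True
      then show False using multiplier_poly_nonzero_quadrant[OF roots degree z _ psi] zero by simp
    next
      case neg: False
      \<comment> \<open>Reflection to the upper half-plane: conjugating coefficients preserves the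
        root condition and commutes with the multiplier, whose values at the nodes are real.\<close>
      define P' where "P' = map_poly cnj P"
      have cnj_poly: "poly (map_poly cnj p) (cnj w) = cnj (poly p w)" for p w
        by (simp add: poly_altdef coeff_map_poly degree_map_poly)
      have "poly P' w = 0 \<Longrightarrow> w \<in> \<real> \<and> Re w < 0" for w
        using cnj_poly[of P "cnj w"] roots[of "cnj w"] by (auto simp: P'_def complex_is_Real_iff)
      moreover have "0 < degree P'" using degree by (simp add: P'_def degree_map_poly)
      moreover have "0 \<le> Re (cnj z)" "0 < Im (cnj z)" using z neg False by auto
      moreover have "multiplier_poly \<psi> P' = map_poly cnj (multiplier_poly \<psi> P)"
        by (rule poly_eqI) (simp only: P'_def coeff_multiplier_poly coeff_map_poly complex_cnj_zero complex_cnj_mult psi_real complex_cnj_complex_of_real)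
      ultimately show False
        using multiplier_poly_nonzero_quadrant[OF _ _ _ _ psi, of P' "cnj z"] zero cnj_poly by simp
    qed
  qed
qed

end
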